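(* Let $\mathcal{G} = (P, X, \leqslant, \leqslant^*, \vartriangleleft)$ be a Gowers space satisfying the pigeonhole principle, and let $\mathcal{X}\subseteq X^\omega$ be a strategically Ramsey set. Then for all $p\in P$ there exists $q\leqslant p$ such that in the game $F_q$, player I has a strategy either to reach $\mathcal{X}$, or to reach $\mathcal{X}^c$.
   Context: For a set $X$, $\mathrm{Seq}(X) = X^{<\omega}\setminus\{\varnothing\}$; $s^\frown x$ is the sequence $s$ extended by the single term $x$. A \emph{Gowers space} is a quintuple $\mathcal{G} = (P, X, \leqslant, \leqslant^*, \vartriangleleft)$, where $P$ is a nonempty set, $X$ is an at most countable nonempty set, $\leqslant$ and $\leqslant^*$ are quasiorders on $P$, and $\vartriangleleft\ \subseteq \mathrm{Seq}(X)\times P$, such that: (1) for all $p,q\in P$, if $p\leqslant q$ then $p\leqslant^* q$; (2) for all $p,q\in P$, if $p\leqslant^* q$ then there is $r\in P$ with $r\leqslant p$, $r\leqslant q$ and $p\leqslant^* r$; (3) for every $\leqslant$-decreasing sequence $(p_i)_{i\in\omega}$ in $P$ there is $p^*\in P$ with $p^*\leqslant^* p_i$ for all $i$; (4) for every $p\in P$ and $s\in X^{<\omega}$ there is $x\in X$ with $s^\frown x\vartriangleleft p$; (5) for every $s\in\mathrm{Seq}(X)$ and $p,q\in P$, if $s\vartriangleleft p$ and $p\leqslant q$ then $s\vartriangleleft q$. Write $p\lessapprox q$ when $p\leqslant q$ and $q\leqslant^* p$. For $q\in P$, $s\in X^{<\omega}$, $A\subseteq X$, write $q\subseteq_s A$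 if every $x\in X$ with $s^\frown x\vartriangleleft q$ belongs to $A$. $\mathcal{G}$ satisfies the \emph{pigeonhole principle} if for every $p\in P$, $s\in X^{<\omega}$ and $A\subseteq X$ there is $q\leqslant p$ such that either $q\subseteq_s A$ or $q\subseteq_s A^c$. For $p\in P$, \emph{Gowers' game} $G_p$: I plays $p_0$, II plays $x_0$, I plays $p_1$, II plays $x_1$, etc., with $p_i\in P$, $x_i\in X$. Rule for I: $p_i\leqslant p$ for all $i$. Rule for II: $(x_0,\ldots,x_i)\vartriangleleft p_i$ for all $i$. The outcome is $(x_i)_{i\in\omega}\in X^\omega$. The \emph{asymptotic game} $F_p$ is defined in the same way except that I is moreover required to play $p_i\lessapprox p$. A player \emph{has a strategy to reach} a set $\mathcal{Y}$ in a game if she/he has a winning strategy in the game with those rules and whose winning condition for that player is that the outcome belongs to $\mathcal{Y}$. A set $\mathcal{X}\subseteq X^\omega$ is \emph{strategically Ramsey} if for every $p\in P$ there is $q\leqslant p$ such that either I has a strategy to reach $\mathcal{X}^c$ in $F_q$, or II has a strategy to reach $\mathcal{X}$ in $G_q$. *)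

theory Defs
  imports Main "HOL-Library.Countable_Set" "HOL-Library.FuncSet"
begin

text \<open>
  The relations are predicates on the underlying types; only their restrictions to the carriers
  \<open>P\<close>, \<open>X\<close> and \<open>Seq(X)\<close> matter, and everything below is relativised to the carriers.
  Finite sequences are lists, with \<open>lists X\<close> for the set of all finite sequences in \<open>X\<close>.
\<close>

record ('p, 'x) gspace =
  conds :: "'p set"
  points :: "'x set"
  le :: "'p \<Rightarrow> 'p \<Rightarrow> bool" (infix "\<sqsubseteq>\<index>" 50)
  le_star :: "'p \<Rightarrow> 'p \<Rightarrow> bool" (infix "\<sqsubseteq>\<^sup>*\<index>" 50)
  below :: "'x list \<Rightarrow> 'p \<Rightarrow> bool" (infix "\<lhd>\<index>" 50)

definition Seq :: "'x set \<Rightarrow> 'x list set" where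
  "Seq X = lists X - {[]}"

definition gowers_space :: "('p, 'x) gspace \<Rightarrow> bool" where
  "gowers_space G \<longleftrightarrow>
    conds G \<noteq> {} \<and>
    points G \<noteq> {} \<and> countable (points G) \<and>
    reflp_on (conds G) (le G) \<and> transp_on (conds G) (le G) \<and>
    reflp_on (conds G) (le_star G) \<and> transp_on (conds G) (le_star G) \<and>
    (\<forall>p\<in>conds G. \<forall>q\<in>conds G. p \<sqsubseteq>\<^bsub>G\<^esub> q \<longrightarrow> p \<sqsubseteq>\<^sup>*\<^bsub>G\<^esub> q) \<and>
    (\<forall>p\<in>conds G. \<forall>q\<in>conds G. p \<sqsubseteq>\<^sup>*\<^bsub>G\<^esub> q \<longrightarrow>
      (\<exists>r\<in>conds G. r \<sqsubseteq>\<^bsub>G\<^esub> p \<and> r \<sqsubseteq>\<^bsub>G\<^esub> q \<and> p \<sqsubseteq>\<^sup>*\<^bsub>G\<^esub> r)) \<and>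
    (\<forall>p :: nat \<Rightarrow> 'p. (\<forall>i. p i \<in> conds G) \<and> (\<forall>i. p (Suc i) \<sqsubseteq>\<^bsub>G\<^esub> p i) \<longrightarrow>
      (\<exists>r\<in>conds G. \<forall>i. r \<sqsubseteq>\<^sup>*\<^bsub>G\<^esub> p i)) \<and>
    (\<forall>p\<in>conds G. \<forall>s\<in>lists (points G). \<exists>x\<in>points G. s @ [x] \<lhd>\<^bsub>G\<^esub> p) \<and>
    (\<forall>s\<in>Seq (points G). \<forall>p\<in>conds G. \<forall>q\<in>conds G. s \<lhd>\<^bsub>G\<^esub> p \<and> p \<sqsubseteq>\<^bsub>G\<^esub> q \<longrightarrow> s \<lhd>\<^bsub>G\<^esub> q)"

definition le_approx :: "('p, 'x) gspace \<Rightarrow> 'p \<Rightarrow> 'p \<Rightarrow> bool" where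
  "le_approx G p q \<longleftrightarrow> p \<sqsubseteq>\<^bsub>G\<^esub> q \<and> q \<sqsubseteq>\<^sup>*\<^bsub>G\<^esub> p"

definition subset_at :: "('p, 'x) gspace \<Rightarrow> 'x list \<Rightarrow> 'p \<Rightarrow> 'x set \<Rightarrow> bool" where
  "subset_at G s q A \<longleftrightarrow> (\<forall>x\<in>points G. s @ [x] \<lhd>\<^bsub>G\<^esub> q \<longrightarrow> x \<in> A)"

definition pigeonhole :: "('p, 'x) gspace \<Rightarrow> bool" where
  "pigeonhole G \<longleftrightarrow>
    (\<forall>p\<in>conds G. \<forall>s\<in>lists (points G). \<forall>A\<subseteq>points G.
      \<exists>q\<in>conds G. q \<sqsubseteq>\<^bsub>G\<^esub> p \<and> (subset_at G s q A \<or> subset_at G s q (points G - A)))"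

definition outcomes :: "('p, 'x) gspace \<Rightarrow> (nat \<Rightarrow> 'x) set" where
  "outcomes G = UNIV \<rightarrow> points G"

definition init :: "(nat \<Rightarrow> 'a) \<Rightarrow> nat \<Rightarrow> 'a list" where
  "init f n = map f [0..<n]"

definition II_legal :: "('p, 'x) gspace \<Rightarrow> (nat \<Rightarrow> 'p) \<Rightarrow> (nat \<Rightarrow> 'x) \<Rightarrow> nat \<Rightarrow> bool" where
  "II_legal G p x i \<longleftrightarrow> x i \<in> points G \<and> init x (Suc i) \<lhd>\<^bsub>G\<^esub> p i"

text \<open>
  The games \<open>G\<^sub>p\<close> and \<open>F\<^sub>p\<close> differ only in the set \<open>M\<close> of moves allowed to player I. A strategy maps
  the finite sequence of the opponent's earlier moves to the next move. It is winning if it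
  prescribes a legal move whenever the opponent has so far played legally, and the outcome is in
  the target set whenever the opponent plays legally throughout.
\<close>

definition Gowers_moves :: "('p, 'x) gspace \<Rightarrow> 'p \<Rightarrow> 'p set" where
  "Gowers_moves G p = {q \<in> conds G. q \<sqsubseteq>\<^bsub>G\<^esub> p}"

definition asymptotic_moves :: "('p, 'x) gspace \<Rightarrow> 'p \<Rightarrow> 'p set" where
  "asymptotic_moves G p = {q \<in> conds G. le_approx G q p}"

definition I_can_reach :: "('p, 'x) gspace \<Rightarrow> 'p set \<Rightarrow> (nat \<Rightarrow> 'x) set \<Rightarrow> bool" where
  "I_can_reach G M Y \<longleftrightarrow>
    (\<exists>\<sigma> :: 'x list \<Rightarrow> 'p. \<forall>p x. (\<forall>n. p n = \<sigma> (init x n)) \<longrightarrow>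
      (\<forall>n. (\<forall>i<n. II_legal G p x i) \<longrightarrow> p n \<in> M) \<and>
      ((\<forall>i. II_legal G p x i) \<longrightarrow> x \<in> Y))"

definition II_can_reach :: "('p, 'x) gspace \<Rightarrow> 'p set \<Rightarrow> (nat \<Rightarrow> 'x) set \<Rightarrow> bool" where
  "II_can_reach G M Y \<longleftrightarrow>
    (\<exists>\<tau> :: 'p list \<Rightarrow> 'x. \<forall>p x. (\<forall>n. x n = \<tau> (init p (Suc n))) \<longrightarrow>
      (\<forall>n. (\<forall>i\<le>n. p i \<in> M) \<longrightarrow> II_legal G p x n) \<and>
      ((\<forall>i. p i \<in> M) \<longrightarrow> x \<in> Y))"

definition strategically_Ramsey :: "('p, 'x) gspace \<Rightarrow> (nat \<Rightarrow> 'x) set \<Rightarrow> bool" where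
  "strategically_Ramsey G \<X> \<longleftrightarrow> \<X> \<subseteq> outcomes G \<and>
    (\<forall>p\<in>conds G. \<exists>q\<in>conds G. q \<sqsubseteq>\<^bsub>G\<^esub> p \<and>
      (I_can_reach G (asymptotic_moves G q) (outcomes G - \<X>) \<or>
       II_can_reach G (Gowers_moves G q) \<X>))"

end

theory Submission
  imports Defs
begin

text \<open>
  Strategic Ramseyness gives some \<open>q \<sqsubseteq> p\<close>; if I reaches the complement in \<open>F\<^sub>q\<close>, nothing is left to
  do. Otherwise II has a strategy \<open>\<tau>\<close> reaching \<open>\<X>\<close> in Gowers' game \<open>G\<^sub>q\<close>, and the point is that the
  pigeonhole principle lets I take over this strategy in the asymptotic game below \<open>q\<close>, although
  there it is II who chooses the points.

  Each sequence \<open>s\<close> of points that \<open>\<tau>\<close> can produce is assigned one play of I against \<open>\<tau>\<close> producing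
  it, in such a way that the plays assigned to the initial segments of \<open>s\<close> are initial segments of the
  play assigned to \<open>s\<close>. Let \<open>A\<^sub>s\<close> be the set of the answers that \<open>\<tau>\<close> can give to one further move after
  that play. No \<open>r \<sqsubseteq> q\<close> has all its one-point extensions of \<open>s\<close> outside \<open>A\<^sub>s\<close>, since I may play \<open>r\<close>
  itself and \<open>\<tau>\<close> must answer legally; so the pigeonhole principle yields conditions all of whose
  extensions of \<open>s\<close> are in \<open>A\<^sub>s\<close> (\<open>pigeonhole_answers\<close>). A fusion over the countably many \<open>s\<close>
  (\<open>fusion\<close>) gives one \<open>q' \<sqsubseteq> q\<close> such that a condition of this kind is a legal move of I in the
  asymptotic game below \<open>q'\<close>, for every \<open>s\<close>. If I plays these conditions, whatever II
  plays is again an answer of \<open>\<tau>\<close>, so the whole outcome is produced by \<open>\<tau>\<close> and belongs to \<open>\<X>\<close>.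
\<close>

section \<open>Fusion in Gowers spaces\<close>

lemma gowers_space_trans:
  assumes "gowers_space G" and "p \<in> conds G" and "q \<in> conds G" and "r \<in> conds G"
  shows "p \<sqsubseteq>\<^bsub>G\<^esub> q \<Longrightarrow> q \<sqsubseteq>\<^bsub>G\<^esub> r \<Longrightarrow> p \<sqsubseteq>\<^bsub>G\<^esub> r"
    and "p \<sqsubseteq>\<^sup>*\<^bsub>G\<^esub> q \<Longrightarrow> q \<sqsubseteq>\<^sup>*\<^bsub>G\<^esub> r \<Longrightarrow> p \<sqsubseteq>\<^sup>*\<^bsub>G\<^esub> r"
proof -
  have "transp_on (conds G) (le G)" and "transp_on (conds G) (le_star G)"
    using assms(1) by (simp_all add: gowers_space_def)
  then show "p \<sqsubseteq>\<^bsub>G\<^esub> q \<Longrightarrow> q \<sqsubseteq>\<^bsub>G\<^esub> r \<Longrightarrow> p \<sqsubseteq>\<^bsub>G\<^esub> r"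
    and "p \<sqsubseteq>\<^sup>*\<^bsub>G\<^esub> q \<Longrightarrow> q \<sqsubseteq>\<^sup>*\<^bsub>G\<^esub> r \<Longrightarrow> p \<sqsubseteq>\<^sup>*\<^bsub>G\<^esub> r"
    using assms(2-4) by (auto dest: transp_onD)
qed

lemma gowers_space_refl:
  assumes "gowers_space G" and "p \<in> conds G"
  shows "p \<sqsubseteq>\<^bsub>G\<^esub> p"
proof -
  have "reflp_on (conds G) (le G)"
    using assms(1) by (simp add: gowers_space_def)
  then show ?thesis
    using assms(2) by (rule reflp_onD)
qed

lemma subset_at_mono:
  assumes "gowers_space G" and "s \<in> lists (points G)"
    and "p \<in> conds G" and "q \<in> conds G" and "p \<sqsubseteq>\<^bsub>G\<^esub> q" and "subset_at G s q A"
  shows "subset_at G s p A"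
proof -
  have "s @ [x] \<in> Seq (points G)" if "x \<in> points G" for x
    using that assms(2) by (auto simp: Seq_def)
  moreover have "\<forall>s\<in>Seq (points G). \<forall>p\<in>conds G. \<forall>q\<in>conds G.
      s \<lhd>\<^bsub>G\<^esub> p \<and> p \<sqsubseteq>\<^bsub>G\<^esub> q \<longrightarrow> s \<lhd>\<^bsub>G\<^esub> q"
    using assms(1) unfolding gowers_space_def by (elim conjE)
  ultimately show ?thesis
    using assms(3-6) unfolding subset_at_def by blast
qed

text \<open>
  A decreasing sequence is built that meets the requirements \<open>\<Phi> s\<close> one after the other. A diagonal
  condition is only \<open>\<sqsubseteq>\<^sup>*\<close> the terms of this sequence, so it need not satisfy any \<open>\<Phi> s\<close> itself. But if
  \<open>t \<sqsubseteq>\<^sup>* u\<close>, then \<open>t\<close> and \<open>u\<close> have a common strengthening that is \<open>\<lessapprox> t\<close>, that is, a legal move in the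
  asymptotic game below \<open>t\<close>, and it inherits the requirement met by \<open>u\<close>.
\<close>

lemma fusion:
  fixes G :: "('p, 'x) gspace" and \<Phi> :: "'s \<Rightarrow> 'p \<Rightarrow> bool"
  assumes G: "gowers_space G" and p: "p \<in> conds G"
    and S: "countable S"
    and dense: "\<And>s q. s \<in> S \<Longrightarrow> q \<in> conds G \<Longrightarrow> q \<sqsubseteq>\<^bsub>G\<^esub> p \<Longrightarrow> \<exists>r\<in>conds G. r \<sqsubseteq>\<^bsub>G\<^esub> q \<and> \<Phi> s r"
    and hereditary: "\<And>s q r. s \<in> S \<Longrightarrow> q \<in> conds G \<Longrightarrow> r \<in> conds G \<Longrightarrow> r \<sqsubseteq>\<^bsub>G\<^esub> q \<Longrightarrow> \<Phi> s q \<Longrightarrow> \<Phi> s r"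
  shows "\<exists>q\<in>conds G. q \<sqsubseteq>\<^bsub>G\<^esub> p \<and> (\<forall>s\<in>S. \<exists>r\<in>asymptotic_moves G q. \<Phi> s r)"
proof (cases "S = {}")
  case True
  with p gowers_space_refl[OF G p] show ?thesis by blast
next
  case False
  define e where "e = from_nat_into S"
  have e: "e n \<in> S" for n
    unfolding e_def by (rule from_nat_into[OF False])
  have refl: "p \<sqsubseteq>\<^bsub>G\<^esub> p"
    using G p by (rule gowers_space_refl)
  define ok where "ok n q \<longleftrightarrow> q \<in> conds G \<and> q \<sqsubseteq>\<^bsub>G\<^esub> p \<and> (n = 0 \<longrightarrow> q = p)" for n :: nat and q
  have start: "\<exists>q. ok 0 q"
    using p refl by (simp add: ok_def)
  have step: "\<exists>r. ok (Suc n) r \<and> (r \<sqsubseteq>\<^bsub>G\<^esub> q \<and> \<Phi> (e n) r)" if "ok n q" for q n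
  proof -
    have q: "q \<in> conds G" "q \<sqsubseteq>\<^bsub>G\<^esub> p"
      using that by (simp_all add: ok_def)
    from dense[OF e q] obtain r where r: "r \<in> conds G" "r \<sqsubseteq>\<^bsub>G\<^esub> q" "\<Phi> (e n) r" by blast
    from gowers_space_trans(1)[OF G r(1) q(1) p r(2) q(2)] r show ?thesis
      by (auto simp: ok_def)
  qed
  obtain q where "\<And>n. ok n (q n)" and q': "\<And>n. q (Suc n) \<sqsubseteq>\<^bsub>G\<^esub> q n" "\<And>n. \<Phi> (e n) (q (Suc n))"
    using dependent_nat_choice[of ok "\<lambda>n q r. r \<sqsubseteq>\<^bsub>G\<^esub> q \<and> \<Phi> (e n) r", OF start step] by metis
  then have q: "\<And>n. q n \<in> conds G" "q 0 = p"
    "\<And>n. q (Suc n) \<sqsubseteq>\<^bsub>G\<^esub> q n" "\<And>n. \<Phi> (e n) (q (Suc n))"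
    by (simp_all add: ok_def)
  have "\<forall>p. (\<forall>i. p i \<in> conds G) \<and> (\<forall>i. p (Suc i) \<sqsubseteq>\<^bsub>G\<^esub> p i) \<longrightarrow>
      (\<exists>r\<in>conds G. \<forall>i. r \<sqsubseteq>\<^sup>*\<^bsub>G\<^esub> p i)"
    using G by (simp add: gowers_space_def)
  from this[rule_format, of q] q(1,3)
  obtain r where r: "r \<in> conds G" "\<And>i. r \<sqsubseteq>\<^sup>*\<^bsub>G\<^esub> q i"
    by blast
  have meet: "\<exists>c\<in>conds G. c \<sqsubseteq>\<^bsub>G\<^esub> a \<and> c \<sqsubseteq>\<^bsub>G\<^esub> b \<and> a \<sqsubseteq>\<^sup>*\<^bsub>G\<^esub> c"
    if "a \<in> conds G" "b \<in> conds G" "a \<sqsubseteq>\<^sup>*\<^bsub>G\<^esub> b" for a b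
    using G that by (simp add: gowers_space_def)
  \<comment> \<open>The diagonal condition \<open>r\<close> is not known to be \<open>\<sqsubseteq> p\<close>, which \<open>t\<close> repairs.\<close>
  obtain t where t: "t \<in> conds G" "t \<sqsubseteq>\<^bsub>G\<^esub> r" "t \<sqsubseteq>\<^bsub>G\<^esub> p"
    using meet[OF r(1) p] r(2)[of 0] q(2) by auto
  have "t \<sqsubseteq>\<^sup>*\<^bsub>G\<^esub> r"
    using G r(1) t by (simp add: gowers_space_def)
  then have t_star: "t \<sqsubseteq>\<^sup>*\<^bsub>G\<^esub> q n" for n
    using gowers_space_trans(2)[OF G t(1) r(1) q(1)] r(2) by blast
  have "\<exists>u\<in>asymptotic_moves G t. \<Phi> s u" if s: "s \<in> S" for s
  proof -
    obtain n where n: "s = e n"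
      unfolding e_def using from_nat_into_surj[OF S s] by metis
    obtain u where "u \<in> conds G" "u \<sqsubseteq>\<^bsub>G\<^esub> t" "u \<sqsubseteq>\<^bsub>G\<^esub> q (Suc n)" "t \<sqsubseteq>\<^sup>*\<^bsub>G\<^esub> u"
      using meet[OF t(1) q(1) t_star] by blast
    then show ?thesis
      using hereditary[OF e q(1) _ _ q(4)] n
      unfolding asymptotic_moves_def le_approx_def by blast
  qed
  with t show ?thesis by blast
qed

section \<open>Plays against a strategy of player II\<close>

lemma init_Suc: "init f (Suc n) = init f n @ [f n]"
  by (simp add: init_def)

lemma init_cong: "(\<And>i. i < n \<Longrightarrow> f i = g i) \<Longrightarrow> init f n = init g n"
  by (simp add: init_def)

lemma length_init [simp]: "length (init f n) = n"
  by (simp add: init_def)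

text \<open>
  A canonical play of I making \<open>\<tau>\<close> produce \<open>s\<close>. Folding from the left makes the choices coherent:
  the play for \<open>s @ [x]\<close> prolongs the one for \<open>s\<close>. It is meaningful only when suitable moves exist
  at all stages, which is what \<open>produced\<close> says.
\<close>

definition play :: "('p list \<Rightarrow> 'x) \<Rightarrow> 'p set \<Rightarrow> 'x list \<Rightarrow> 'p list" where
  "play \<tau> M s = foldl (\<lambda>ps x. ps @ [SOME p. p \<in> M \<and> \<tau> (ps @ [p]) = x]) [] s"

definition answers :: "('p list \<Rightarrow> 'x) \<Rightarrow> 'p set \<Rightarrow> 'x list \<Rightarrow> 'x set" where
  "answers \<tau> M s = (\<lambda>p. \<tau> (play \<tau> M s @ [p])) ` M"

definition produced :: "('p list \<Rightarrow> 'x) \<Rightarrow> 'p set \<Rightarrow> 'x list \<Rightarrow> bool" where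
  "produced \<tau> M s \<longleftrightarrow> (\<forall>i<length s. s ! i \<in> answers \<tau> M (take i s))"

lemma play_snoc:
  "play \<tau> M (s @ [x]) = play \<tau> M s @ [SOME p. p \<in> M \<and> \<tau> (play \<tau> M s @ [p]) = x]"
  by (simp add: play_def)

lemma produced_snoc:
  "produced \<tau> M (s @ [x]) \<longleftrightarrow> produced \<tau> M s \<and> x \<in> answers \<tau> M s"
  by (auto simp: produced_def nth_append less_Suc_eq)

lemma play_last_move:
  assumes "x \<in> answers \<tau> M s"
  shows "last (play \<tau> M (s @ [x])) \<in> M" and "\<tau> (play \<tau> M (s @ [x])) = x"
proof -
  have "\<exists>p. p \<in> M \<and> \<tau> (play \<tau> M s @ [p]) = x"
    using assms by (auto simp: answers_def)
  from someI_ex[OF this]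
  show "last (play \<tau> M (s @ [x])) \<in> M" and "\<tau> (play \<tau> M (s @ [x])) = x"
    by (simp_all add: play_snoc)
qed

text \<open>
  Coherence lets the canonical plays for the initial segments of an infinite sequence be glued
  into one infinite play.
\<close>

lemma play_init:
  "play \<tau> M (init x n) = init (\<lambda>i. last (play \<tau> M (init x (Suc i)))) n"
  by (induction n) (simp add: init_def play_def, simp add: init_Suc play_snoc)

lemma play_follows_strategy:
  assumes "\<And>i. i < n \<Longrightarrow> x i \<in> answers \<tau> M (init x i)" and "i < n"
  defines "p \<equiv> \<lambda>i. last (play \<tau> M (init x (Suc i)))"
  shows "p i \<in> M" and "x i = \<tau> (init p (Suc i))"
proof -
  show "p i \<in> M"
    unfolding p_def init_Suc using play_last_move(1)[OF assms(1)[OF assms(2)]] .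
  show "x i = \<tau> (init p (Suc i))"
    unfolding p_def play_init[symmetric] unfolding init_Suc
    using play_last_move(2)[OF assms(1)[OF assms(2)]] by simp
qed

lemma produced_initD:
  assumes "produced \<tau> M (init x n)" and "i < n"
  shows "x i \<in> answers \<tau> M (init x i)"
proof -
  have "take i (init x n) = init x i" and "init x n ! i = x i"
    using assms(2) by (simp_all add: init_def take_map)
  with assms show ?thesis
    unfolding produced_def by (metis length_init)
qed

section \<open>Transferring a strategy of player II to player I\<close>

text \<open>
  Winning for one given \<open>\<tau>\<close>: the canonical plays depend on the choice of the strategy.
\<close>

definition II_strategy ::
    "('p, 'x) gspace \<Rightarrow> 'p set \<Rightarrow> (nat \<Rightarrow> 'x) set \<Rightarrow> ('p list \<Rightarrow> 'x) \<Rightarrow> bool" where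
  "II_strategy G M Y \<tau> \<longleftrightarrow> (\<forall>p x. (\<forall>n. x n = \<tau> (init p (Suc n))) \<longrightarrow>
      (\<forall>n. (\<forall>i\<le>n. p i \<in> M) \<longrightarrow> II_legal G p x n) \<and>
      ((\<forall>i. p i \<in> M) \<longrightarrow> x \<in> Y))"

lemma II_strategy_legal:
  assumes \<tau>: "II_strategy G M Y \<tau>" and s: "produced \<tau> M s" and r: "r \<in> M"
  defines "y \<equiv> \<tau> (play \<tau> M s @ [r])"
  shows "y \<in> points G" and "s @ [y] \<lhd>\<^bsub>G\<^esub> r"
proof -
  \<comment> \<open>Strategies are defined through infinite plays, so the finite one is prolonged by repeating
    \<open>r\<close>; the padding of \<open>s\<close> in \<open>z\<close> serves only to apply the lemmas on infinite sequences to it.\<close>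
  let ?n = "length s"
  define z where "z i = (if i < ?n then s ! i else y)" for i
  define p where "p i = (if i < ?n then last (play \<tau> M (init z (Suc i))) else r)" for i
  define x where "x i = \<tau> (init p (Suc i))" for i
  have z: "init z ?n = s"
    by (rule nth_equalityI) (auto simp: init_def z_def)
  have ans: "z i \<in> answers \<tau> M (init z i)" if "i < ?n" for i
    using produced_initD[of \<tau> M z ?n] s that z by simp
  have "init p ?n = play \<tau> M (init z ?n)"
    by (subst play_init, rule init_cong) (simp add: p_def)
  then have xn: "x ?n = y"
    by (simp add: x_def init_Suc z y_def p_def)
  have "x i = z i" if "i < ?n" for i
  proof -
    have "init p (Suc i) = init (\<lambda>i. last (play \<tau> M (init z (Suc i)))) (Suc i)"
      using that by (intro init_cong) (simp add: p_def)
    then show ?thesis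
      using play_follows_strategy(2)[OF ans that] by (simp add: x_def)
  qed
  then have xs: "init x ?n = s"
    using init_cong[of ?n x z] z by simp
  have "\<forall>i. p i \<in> M"
    using play_follows_strategy(1)[OF ans] r by (simp add: p_def)
  moreover have "\<forall>n. x n = \<tau> (init p (Suc n))"
    by (simp add: x_def)
  ultimately have "II_legal G p x ?n"
    using \<tau>[unfolded II_strategy_def, rule_format, of x p] by simp
  then show "y \<in> points G" and "s @ [y] \<lhd>\<^bsub>G\<^esub> r"
    by (simp_all add: II_legal_def init_Suc xn xs p_def)
qed

text \<open>
  The other alternative of the pigeonhole principle is refuted by letting I play the condition \<open>r\<close>
  that it provides: the answer of \<open>\<tau>\<close> is a legal extension of \<open>s\<close> for \<open>r\<close>, and it is an answer.
\<close>

lemma pigeonhole_answers: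
  assumes G: "gowers_space G" and pigeonhole: "pigeonhole G"
    and p: "p \<in> conds G" and \<tau>: "II_strategy G (Gowers_moves G p) Y \<tau>"
    and s: "s \<in> lists (points G)" "produced \<tau> (Gowers_moves G p) s"
    and q: "q \<in> conds G" "q \<sqsubseteq>\<^bsub>G\<^esub> p"
  shows "\<exists>r\<in>conds G. r \<sqsubseteq>\<^bsub>G\<^esub> q \<and> subset_at G s r (answers \<tau> (Gowers_moves G p) s)"
proof -
  let ?M = "Gowers_moves G p"
  let ?A = "answers \<tau> ?M s \<inter> points G"
  obtain r where r: "r \<in> conds G" "r \<sqsubseteq>\<^bsub>G\<^esub> q"
    and alt: "subset_at G s r ?A \<or> subset_at G s r (points G - ?A)"
    using pigeonhole q(1) s(1) unfolding pigeonhole_def by (meson Int_lower2)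
  have rM: "r \<in> ?M"
    using r q(2) gowers_space_trans(1)[OF G r(1) q(1) p] by (simp add: Gowers_moves_def)
  let ?y = "\<tau> (play \<tau> ?M s @ [r])"
  have "?y \<in> ?A" and "s @ [?y] \<lhd>\<^bsub>G\<^esub> r"
    using II_strategy_legal[OF \<tau> s(2) rM] rM by (auto simp: answers_def)
  then have "\<not> subset_at G s r (points G - ?A)"
    unfolding subset_at_def by blast
  with alt r show ?thesis
    unfolding subset_at_def by blast
qed

text \<open>
  Fusion over all sequences \<open>s\<close> gives I a strategy whose moves confine the next point to
  the answers of \<open>\<tau>\<close>. The outcome is then also the outcome of a play against \<open>\<tau>\<close> in Gowers' game
  below \<open>p\<close>, in which I plays the canonical moves rather than those of the asymptotic play.
\<close>

theorem II_Gowers_imp_I_asymptotic: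
  assumes G: "gowers_space G" and pigeonhole: "pigeonhole G" and p: "p \<in> conds G"
    and II: "II_can_reach G (Gowers_moves G p) Y"
  shows "\<exists>q\<in>conds G. q \<sqsubseteq>\<^bsub>G\<^esub> p \<and> I_can_reach G (asymptotic_moves G q) Y"
proof -
  let ?M = "Gowers_moves G p"
  let ?L = "lists (points G)"
  obtain \<tau> where \<tau>: "II_strategy G ?M Y \<tau>"
    using II unfolding II_can_reach_def II_strategy_def by blast
  define \<Phi> where "\<Phi> s r \<longleftrightarrow> (produced \<tau> ?M s \<longrightarrow> subset_at G s r (answers \<tau> ?M s))" for s r
  have "\<exists>q\<in>conds G. q \<sqsubseteq>\<^bsub>G\<^esub> p \<and> (\<forall>s\<in>?L. \<exists>r\<in>asymptotic_moves G q. \<Phi> s r)"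
  proof (rule fusion[OF G p])
    show "countable ?L"
      using G by (simp add: gowers_space_def countable_lists)
    show "\<exists>r\<in>conds G. r \<sqsubseteq>\<^bsub>G\<^esub> q \<and> \<Phi> s r"
      if "s \<in> ?L" "q \<in> conds G" "q \<sqsubseteq>\<^bsub>G\<^esub> p" for s q
    proof (cases "produced \<tau> ?M s")
      case True
      then show ?thesis
        using pigeonhole_answers[OF G pigeonhole p \<tau> that(1) True that(2,3)]
        by (simp add: \<Phi>_def)
    next
      case False
      moreover have "q \<sqsubseteq>\<^bsub>G\<^esub> q"
        using G that(2) by (rule gowers_space_refl)
      ultimately show ?thesis
        using that(2) by (auto simp: \<Phi>_def)
    qed
    show "\<Phi> s r" if "s \<in> ?L" "q \<in> conds G" "r \<in> conds G" "r \<sqsubseteq>\<^bsub>G\<^esub> q" "\<Phi> s q" for s q r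
      using subset_at_mono[OF G that(1,3,2,4)] that(5) by (simp add: \<Phi>_def)
  qed
  then obtain q \<sigma> where q: "q \<in> conds G" "q \<sqsubseteq>\<^bsub>G\<^esub> p"
    and \<sigma>: "\<And>s. s \<in> ?L \<Longrightarrow> \<sigma> s \<in> asymptotic_moves G q" "\<And>s. s \<in> ?L \<Longrightarrow> \<Phi> s (\<sigma> s)"
    by metis
  have "I_can_reach G (asymptotic_moves G q) Y"
    unfolding I_can_reach_def
  proof (intro exI[of _ \<sigma>] allI impI conjI)
    fix c x n
    assume c: "\<forall>n. c n = \<sigma> (init x n)" and "\<forall>i<n. II_legal G c x i"
    then have "init x n \<in> ?L"
      by (auto simp: init_def II_legal_def)
    with c \<sigma>(1) show "c n \<in> asymptotic_moves G q" by simp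
  next
    fix c x
    assume c: "\<forall>n. c n = \<sigma> (init x n)" and legal: "\<forall>i. II_legal G c x i"
    have L: "init x n \<in> ?L" for n
      using legal by (auto simp: init_def II_legal_def)
    have "produced \<tau> ?M (init x n)" for n
    proof (induction n)
      case 0
      show ?case by (simp add: produced_def)
    next
      case (Suc n)
      then have "subset_at G (init x n) (c n) (answers \<tau> ?M (init x n))"
        using \<sigma>(2)[OF L[of n]] c by (simp add: \<Phi>_def)
      moreover have "x n \<in> points G" and "init x n @ [x n] \<lhd>\<^bsub>G\<^esub> c n"
        using legal by (simp_all add: II_legal_def init_Suc)
      ultimately show ?case
        using Suc by (simp add: subset_at_def init_Suc produced_snoc)
    qed
    then have ans: "x n \<in> answers \<tau> ?M (init x n)" for n
      using produced_initD lessI by metis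
    define b where "b = (\<lambda>i. last (play \<tau> ?M (init x (Suc i))))"
    have "b i \<in> ?M" and "x i = \<tau> (init b (Suc i))" for i
      using play_follows_strategy[of "Suc i" x \<tau> ?M i] ans by (simp_all add: b_def)
    then show "x \<in> Y"
      using \<tau> unfolding II_strategy_def by blast
  qed
  with q show ?thesis by blast
qed

theorem corollary3p10:
  fixes G :: "('p, 'x) gspace" and \<X> :: "(nat \<Rightarrow> 'x) set"
  assumes "gowers_space G" and "pigeonhole G"
    and "\<X> \<subseteq> outcomes G" and "strategically_Ramsey G \<X>"
  shows "\<forall>p\<in>conds G. \<exists>q\<in>conds G. q \<sqsubseteq>\<^bsub>G\<^esub> p \<and>
    (I_can_reach G (asymptotic_moves G q) \<X> \<or>
     I_can_reach G (asymptotic_moves G q) (outcomes G - \<X>))"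
proof
  fix p assume p: "p \<in> conds G"
  obtain q where q: "q \<in> conds G" "q \<sqsubseteq>\<^bsub>G\<^esub> p"
    and alt: "I_can_reach G (asymptotic_moves G q) (outcomes G - \<X>) \<or>
       II_can_reach G (Gowers_moves G q) \<X>"
    using assms(4) p unfolding strategically_Ramsey_def by blast
  from alt show "\<exists>q\<in>conds G. q \<sqsubseteq>\<^bsub>G\<^esub> p \<and>
    (I_can_reach G (asymptotic_moves G q) \<X> \<or>
     I_can_reach G (asymptotic_moves G q) (outcomes G - \<X>))"
  proof
    assume "II_can_reach G (Gowers_moves G q) \<X>"
    then obtain r where "r \<in> conds G" "r \<sqsubseteq>\<^bsub>G\<^esub> q" "I_can_reach G (asymptotic_moves G r) \<X>"
      using II_Gowers_imp_I_asymptotic[OF assms(1,2) q(1)] by blast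
    then show ?thesis
      using gowers_space_trans(1)[OF assms(1) _ q(1) p] q(2) by blast
  qed (use q in blast)
qed

end
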